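(* Let $G$ be a graph with chromatic number $\chi(G)\geq 4$ (that is, $G$ is not $3$-colorable). Then $G$ has a $K_4$ minor.
   Context: A graph is $k$-colorable if its vertices can be colored with $k$ colors so that adjacent vertices receive different colors (a proper $k$-coloring); $\chi(G)\geq k$ means that $G$ is not $(k-1)$-colorable. A graph $G$ has a $K_k$ minor if there exist $k$ pairwise disjoint nonempty connected subgraphs of $G$ such that each pair of them is joined by an edge of $G$ (an edge with one endpoint in each of the two subgraphs). *)

theory Defs
  imports Complex_Main "HOL-Library.FuncSet" "Graph_Theory.Digraph_Component"
begin

text \<open>
  A graph is a symmetric loop-free digraph without parallel arcs, i.e. a
  \<^typ>\<open>'a pair_pre_digraph\<close> satisfying \<^const>\<open>pair_bidirected_digraph\<close>; the edge \<open>uv\<close> is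
  represented by the two arcs \<open>(u, v)\<close> and \<open>(v, u)\<close>. Graphs may be infinite.
\<close>

definition proper_coloring :: "'a pair_pre_digraph \<Rightarrow> nat \<Rightarrow> ('a \<Rightarrow> nat) \<Rightarrow> bool" where
  "proper_coloring G k c \<longleftrightarrow>
     c \<in> pverts G \<rightarrow> {..<k} \<and> (\<forall>u v. (u, v) \<in> parcs G \<longrightarrow> c u \<noteq> c v)"

definition colorable :: "'a pair_pre_digraph \<Rightarrow> nat \<Rightarrow> bool" where
  "colorable G k \<longleftrightarrow> (\<exists>c. proper_coloring G k c)"

text \<open>
  \<^const>\<open>Digraph_Component.connected\<close> includes nonemptiness of the vertex set. The condition
  \<^const>\<open>pair_bidirected_digraph\<close> on \<open>B i\<close> makes it a subgraph in the undirected sense, as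
  \<^const>\<open>subgraph\<close> alone would admit only one of the two arcs of an edge.
\<close>

definition has_complete_minor :: "'a pair_pre_digraph \<Rightarrow> nat \<Rightarrow> bool" where
  "has_complete_minor G k \<longleftrightarrow>
     (\<exists>B :: nat \<Rightarrow> 'a pair_pre_digraph.
        (\<forall>i<k. pair_bidirected_digraph (B i) \<and>
               subgraph (with_proj (B i)) (with_proj G) \<and>
               Digraph_Component.connected (with_proj (B i))) \<and>
        (\<forall>i<k. \<forall>j<k. i \<noteq> j \<longrightarrow>
           pverts (B i) \<inter> pverts (B j) = {} \<and>
           (\<exists>u\<in>pverts (B i). \<exists>v\<in>pverts (B j). (u, v) \<in> parcs G)))"

end

theory Submission
  imports Defs "HOL-Analysis.Function_Topology" "HOL-Analysis.Product_Topology"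
begin

text \<open>
  A compactness argument reduces the theorem to finite graphs. There it follows by deleting
  vertices of degree at most two, which never obstruct a 3-colouring, once it is known that a
  nonempty finite graph of minimum degree at least three has a \<open>K\<^sub>4\<close> minor.

  For the latter, consider longest paths \<open>x\<^sub>0 x\<^sub>1 \<dots> x\<^sub>n\<close>. All neighbours of the end \<open>x\<^sub>0\<close> lie on
  the path, so some \<open>x\<^sub>a\<close> with \<open>a \<ge> 2\<close> is adjacent to \<open>x\<^sub>0\<close>; choose the path and \<open>a\<close>
  with \<open>a\<close> minimal among all longest paths. Apart from \<open>x\<^sub>1\<close> and \<open>x\<^sub>a\<close>, the vertex \<open>x\<^sub>0\<close> has a
  third neighbour, and by minimality this lies in the tail \<open>x\<^sub>a\<^sub>+\<^sub>1 \<dots> x\<^sub>n\<close>. Rotating the path along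
  the edge \<open>x\<^sub>0 x\<^sub>a\<close> gives another longest path
  \<open>x\<^sub>a\<^sub>-\<^sub>1 \<dots> x\<^sub>0 x\<^sub>a \<dots> x\<^sub>n\<close> with the same tail, so by the same reasoning its end
  \<open>x\<^sub>a\<^sub>-\<^sub>1\<close> has a neighbour in that tail too. Now \<open>{x\<^sub>0, \<dots>, x\<^sub>a\<^sub>-\<^sub>2}\<close>, \<open>{x\<^sub>a\<^sub>-\<^sub>1}\<close>, \<open>{x\<^sub>a}\<close> and
  \<open>{x\<^sub>a\<^sub>+\<^sub>1, \<dots>, x\<^sub>n}\<close> are the branch sets of a \<open>K\<^sub>4\<close> minor: consecutive sets are joined
  by edges of the path, the first and third by the chord \<open>x\<^sub>0 x\<^sub>a\<close>, and the first and second
  are joined to the last by the neighbours of \<open>x\<^sub>0\<close> and \<open>x\<^sub>a\<^sub>-\<^sub>1\<close> in the tail.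
\<close>

section \<open>Induced subgraphs and minors\<close>

definition induced :: "'a pair_pre_digraph \<Rightarrow> 'a set \<Rightarrow> 'a pair_pre_digraph" where
  "induced G S = \<lparr>pverts = S, parcs = parcs G \<inter> S \<times> S\<rparr>"

lemma induced_simps [simp]:
  "pverts (induced G S) = S"
  "parcs (induced G S) = parcs G \<inter> S \<times> S"
  by (simp_all add: induced_def)

lemma bidirected_iff:
  "pair_bidirected_digraph G \<longleftrightarrow>
     parcs G \<subseteq> pverts G \<times> pverts G \<and> sym (parcs G) \<and> irrefl (parcs G)"
  unfolding pair_bidirected_digraph_def pair_sym_digraph_def pair_loopfree_digraph_def
    pair_sym_digraph_axioms_def pair_loopfree_digraph_axioms_def pair_wf_digraph_def
    symmetric_def irrefl_def
  by auto

lemma bidirected_wf: "pair_bidirected_digraph G \<Longrightarrow> wf_digraph (with_proj G)"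
  by (simp add: wf_digraph_wp_iff pair_bidirected_digraph_def pair_sym_digraph_def)

lemma induced_bidirected:
  "pair_bidirected_digraph G \<Longrightarrow> pair_bidirected_digraph (induced G S)"
  unfolding bidirected_iff induced_simps irrefl_def sym_def by blast

lemma induced_subgraph_of:
  assumes "pair_bidirected_digraph G" "S \<subseteq> pverts G"
  shows "subgraph (with_proj (induced G S)) (with_proj G)"
  using assms bidirected_wf[OF assms(1)] bidirected_wf[OF induced_bidirected[OF assms(1)]]
  by (auto simp: subgraph_def compatible_def)

lemma has_complete_minor_mono:
  assumes "has_complete_minor H k" "subgraph (with_proj H) (with_proj G)"
  shows "has_complete_minor G k"
proof -
  obtain B :: "nat \<Rightarrow> 'a pair_pre_digraph" where
    B: "\<forall>i<k. pair_bidirected_digraph (B i) \<and> subgraph (with_proj (B i)) (with_proj H) \<and>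
          Digraph_Component.connected (with_proj (B i))"
    and edges: "\<forall>i<k. \<forall>j<k. i \<noteq> j \<longrightarrow> pverts (B i) \<inter> pverts (B j) = {} \<and>
          (\<exists>u\<in>pverts (B i). \<exists>v\<in>pverts (B j). (u, v) \<in> parcs H)"
    using assms(1) unfolding has_complete_minor_def by blast
  have sub: "parcs H \<subseteq> parcs G" using assms(2) by (simp add: subgraph_def)
  show ?thesis
    unfolding has_complete_minor_def
  proof (intro exI[of _ B] conjI allI impI)
    fix i assume "i < k"
    then show "subgraph (with_proj (B i)) (with_proj G)" using B subgraph_trans[OF _ assms(2)] by simp
  next
    fix i j assume "i < k" "j < k" "i \<noteq> j"
    then show "\<exists>u\<in>pverts (B i). \<exists>v\<in>pverts (B j). (u, v) \<in> parcs G" using edges sub by blast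
  qed (use B edges in auto)
qed

lemma reachable_along_path:
  assumes "wf_digraph (with_proj H)" "set xs \<subseteq> pverts H" "xs \<noteq> []"
    and "successively (\<lambda>u v. (u, v) \<in> parcs H) xs" "u \<in> set xs"
  shows "hd xs \<rightarrow>\<^sup>*\<^bsub>with_proj H\<^esub> u"
  using assms(2-)
proof (induction xs)
  case (Cons x xs)
  interpret wf_digraph "with_proj H" by fact
  show ?case
  proof (cases "u = x")
    case True
    then show ?thesis using Cons.prems by auto
  next
    case False
    with Cons.prems have "xs \<noteq> []" "x \<rightarrow>\<^bsub>with_proj H\<^esub> hd xs"
      by (auto simp: successively_Cons)
    moreover from this have "hd xs \<rightarrow>\<^sup>*\<^bsub>with_proj H\<^esub> u"
      using Cons False by (simp add: successively_Cons)
    ultimately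
    show ?thesis using adj_reachable_trans by auto
  qed
qed simp

text \<open>
  Connectedness of a digraph refers to its symmetric closure; for a symmetric graph this lemma
  makes it a statement about the graph itself.
\<close>

lemma mk_symmetric_of_symmetric:
  assumes "sym (parcs H)"
  shows "mk_symmetric (with_proj H) = H"
proof -
  have "(\<Union>e\<in>parcs H. {(fst e, snd e), (snd e, fst e)}) = parcs H"
    using symD[OF assms] by auto
  then show ?thesis by (simp add: mk_symmetric_def)
qed

lemma path_induces_connected:
  assumes "pair_bidirected_digraph G" "xs \<noteq> []" "successively (\<lambda>u v. (u, v) \<in> parcs G) xs"
  shows "Digraph_Component.connected (with_proj (induced G (set xs)))"
proof -
  let ?H = "induced G (set xs)"
  have bi: "pair_bidirected_digraph ?H" using assms(1) by (rule induced_bidirected)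
  then have sym: "sym (parcs ?H)" by (simp add: bidirected_iff)
  then have eq: "mk_symmetric (with_proj ?H) = ?H" by (rule mk_symmetric_of_symmetric)
  interpret wf_digraph "with_proj ?H" using bi by (rule bidirected_wf)
  have "successively (\<lambda>u v. (u, v) \<in> parcs ?H) xs"
    using assms(3) by (rule successively_mono) auto
  then have from_hd: "hd xs \<rightarrow>\<^sup>*\<^bsub>with_proj ?H\<^esub> u" if "u \<in> set xs" for u
    using reachable_along_path[OF bidirected_wf[OF bi] _ assms(2)] that by simp
  moreover have "u \<rightarrow>\<^sup>*\<^bsub>with_proj ?H\<^esub> hd xs" if "u \<in> set xs" for u
    using symmetric_reachable[OF _ from_hd[OF that]] sym by (simp add: symmetric_def)
  ultimately have "u \<rightarrow>\<^sup>*\<^bsub>with_proj ?H\<^esub> v" if "u \<in> set xs" "v \<in> set xs" for u v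
    using that reachable_trans by blast
  then show ?thesis
    using assms(2) unfolding Digraph_Component.connected_def eq by (intro strongly_connectedI) auto
qed

text \<open>
  Branch sets that are traversed by paths suffice for the minor found below, and they are
  connected because a path is.
\<close>

lemma complete_minor_from_paths:
  assumes "pair_bidirected_digraph G"
    and path: "\<And>i. i < k \<Longrightarrow> P i \<noteq> [] \<and> set (P i) \<subseteq> pverts G \<and>
                 successively (\<lambda>u v. (u, v) \<in> parcs G) (P i)"
    and pair: "\<And>i j. i < j \<Longrightarrow> j < k \<Longrightarrow> set (P i) \<inter> set (P j) = {} \<and>
                 (\<exists>u\<in>set (P i). \<exists>v\<in>set (P j). (u, v) \<in> parcs G)"
  shows "has_complete_minor G k"
proof -
  have sym: "(u, v) \<in> parcs G \<Longrightarrow> (v, u) \<in> parcs G" for u v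
    using assms(1) by (auto simp: bidirected_iff dest: symD)
  have both: "set (P i) \<inter> set (P j) = {} \<and> (\<exists>u\<in>set (P i). \<exists>v\<in>set (P j). (u, v) \<in> parcs G)"
    if "i < k" "j < k" "i \<noteq> j" for i j
  proof (cases "i < j")
    case True
    then show ?thesis using pair that by blast
  next
    case False
    then have "j < i" using that by simp
    then show ?thesis using pair[of j i] that sym by blast
  qed
  show ?thesis
    unfolding has_complete_minor_def
  proof (intro exI[of _ "\<lambda>i. induced G (set (P i))"] conjI allI impI)
    fix i assume "i < k"
    note P = path[OF this]
    show "pair_bidirected_digraph (induced G (set (P i)))"
      using assms(1) by (rule induced_bidirected)
    show "subgraph (with_proj (induced G (set (P i)))) (with_proj G)"
      using induced_subgraph_of[OF assms(1)] P by simp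
    show "Digraph_Component.connected (with_proj (induced G (set (P i))))"
      using path_induces_connected[OF assms(1)] P by simp
  qed (use both in simp_all)
qed

section \<open>Finite graphs of minimum degree three\<close>

definition path_in :: "'a pair_pre_digraph \<Rightarrow> 'a list \<Rightarrow> bool" where
  "path_in G xs \<longleftrightarrow> xs \<noteq> [] \<and> distinct xs \<and> set xs \<subseteq> pverts G \<and>
     successively (\<lambda>u v. (u, v) \<in> parcs G) xs"

definition longest_path_in :: "'a pair_pre_digraph \<Rightarrow> 'a list \<Rightarrow> bool" where
  "longest_path_in G xs \<longleftrightarrow> path_in G xs \<and> (\<forall>ys. path_in G ys \<longrightarrow> length ys \<le> length xs)"

lemma longest_path_exists:
  assumes "finite (pverts G)" "pverts G \<noteq> {}"
  obtains xs where "longest_path_in G xs"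
proof -
  obtain v where "v \<in> pverts G" using assms(2) by auto
  then have "path_in G [v]" by (simp add: path_in_def)
  moreover have "length xs \<le> card (pverts G)" if "path_in G xs" for xs
    using that card_mono[OF assms(1), of "set xs"] distinct_card[of xs] by (simp add: path_in_def)
  ultimately have "\<exists>xs. path_in G xs \<and> (\<forall>ys. path_in G ys \<longrightarrow> length ys \<le> length xs)"
    by (intro ex_has_greatest_nat[of "path_in G" "[v]" length "Suc (card (pverts G))"]) (auto simp: less_Suc_eq_le)
  then show ?thesis using that unfolding longest_path_in_def by blast
qed

lemma longest_path_neighbours:
  assumes "pair_bidirected_digraph G" "longest_path_in G xs" "(hd xs, u) \<in> parcs G"
  shows "u \<in> set xs"
proof (rule ccontr)
  assume "u \<notin> set xs"
  with assms have "path_in G (u # xs)"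
    by (auto simp: longest_path_in_def path_in_def successively_Cons bidirected_iff dest: symD)
  with assms(2) show False by (auto simp: longest_path_in_def)
qed

text \<open>
  Reversing the part of a path before a neighbour \<open>z\<close> of its end keeps it a path, as the old end
  now precedes \<open>z\<close>.
\<close>

lemma rotate_longest_path:
  assumes "pair_bidirected_digraph G" "longest_path_in G (Q @ z # R)" "Q \<noteq> []"
    and "(hd Q, z) \<in> parcs G"
  shows "longest_path_in G (rev Q @ z # R)"
proof -
  have "(\<lambda>u v. (v, u) \<in> parcs G) = (\<lambda>u v. (u, v) \<in> parcs G)"
    using assms(1) by (auto simp: bidirected_iff fun_eq_iff dest: symD)
  then have "successively (\<lambda>u v. (v, u) \<in> parcs G) Q = successively (\<lambda>u v. (u, v) \<in> parcs G) Q"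
    by (rule arg_cong)
  then show ?thesis
    using assms by (auto simp: longest_path_in_def path_in_def successively_append_iff last_rev)
qed

text \<open>
  All neighbours of the end lie on the path, and up to index \<open>a\<close> only the vertices at 1 and \<open>a\<close>
  can be among them. The bound on the chords concerns all longest paths at once, so that it
  passes to a rotated path.
\<close>

lemma third_neighbour_in_tail:
  assumes "pair_bidirected_digraph G" "longest_path_in G xs" "a < length xs"
    and deg: "3 \<le> card (parcs G `` {hd xs})"
    and least: "\<And>ys i. longest_path_in G ys \<Longrightarrow> 2 \<le> i \<Longrightarrow> i < length ys \<Longrightarrow>
                  (hd ys, ys ! i) \<in> parcs G \<Longrightarrow> a \<le> i"
  shows "\<exists>u\<in>set (drop (Suc a) xs). (hd xs, u) \<in> parcs G"
proof (rule ccontr)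
  assume no: "\<not> ?thesis"
  have "parcs G `` {hd xs} \<subseteq> {xs ! 1, xs ! a}"
  proof
    fix u assume "u \<in> parcs G `` {hd xs}"
    then have u: "(hd xs, u) \<in> parcs G" by simp
    then obtain i where i: "i < length xs" "u = xs ! i"
      using longest_path_neighbours[OF assms(1,2)] by (metis in_set_conv_nth)
    have "xs \<noteq> []" using i by auto
    then have "u = hd xs" if "i = 0" using i that by (simp add: hd_conv_nth)
    then have "i \<noteq> 0" using u assms(1) by (auto simp: bidirected_iff irrefl_def)
    moreover have "i \<le> a"
    proof (rule ccontr)
      assume "\<not> i \<le> a"
      then have "u = drop (Suc a) xs ! (i - Suc a)" "i - Suc a < length (drop (Suc a) xs)"
        using i by auto
      then show False using no u nth_mem by metis
    qed
    moreover have "2 \<le> i \<Longrightarrow> a \<le> i" using least[OF assms(2)] u i by simp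
    ultimately have "i = 1 \<or> i = a" by linarith
    then show "u \<in> {xs ! 1, xs ! a}" using i by auto
  qed
  then have "card (parcs G `` {hd xs}) \<le> card {xs ! 1, xs ! a}" by (intro card_mono) auto
  also have "\<dots> \<le> 2" by (simp add: card_insert_if)
  finally show False using deg by simp
qed

lemma min_degree_three_has_K4_minor:
  assumes bi: "pair_bidirected_digraph G" and fin: "finite (pverts G)" "pverts G \<noteq> {}"
    and deg: "\<And>v. v \<in> pverts G \<Longrightarrow> 3 \<le> card (parcs G `` {v})"
  shows "has_complete_minor G 4"
proof -
  let ?chord = "\<lambda>xs a. longest_path_in G xs \<and> 2 \<le> a \<and> a < length xs \<and> (hd xs, xs ! a) \<in> parcs G"
  have hd_deg: "3 \<le> card (parcs G `` {hd xs})" if "longest_path_in G xs" for xs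
    using that deg[of "hd xs"] hd_in_set[of xs]
    unfolding longest_path_in_def path_in_def by blast
  obtain xs0 where xs0: "longest_path_in G xs0" using longest_path_exists fin by blast
  have len: "1 < length xs0"
  proof (rule ccontr)
    assume "\<not> 1 < length xs0"
    moreover have "xs0 \<noteq> []" using xs0 by (auto simp: longest_path_in_def path_in_def)
    ultimately have "set xs0 = {hd xs0}" by (cases xs0) auto
    then have "parcs G `` {hd xs0} \<subseteq> {hd xs0}" using longest_path_neighbours[OF bi xs0] by auto
    then have "card (parcs G `` {hd xs0}) \<le> card {hd xs0}" by (intro card_mono) auto
    then show False using hd_deg[OF xs0] by simp
  qed
  \<comment> \<open>With \<open>a = 1\<close> the bound on the chords is trivial, and a neighbour in the tail gives a chord.\<close>
  obtain u where "u \<in> set (drop (Suc 1) xs0)" "(hd xs0, u) \<in> parcs G"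
    using third_neighbour_in_tail[OF bi xs0 len hd_deg[OF xs0]] by auto
  then obtain i where "i < length (drop (Suc 1) xs0)" "(hd xs0, drop (Suc 1) xs0 ! i) \<in> parcs G"
    by (metis in_set_conv_nth)
  then have "?chord xs0 (Suc 1 + i)" using xs0 by simp
  then have ex: "\<exists>a xs. ?chord xs a" by blast
  define a where "a = (LEAST a. \<exists>xs. ?chord xs a)"
  obtain xs where xs: "longest_path_in G xs" "2 \<le> a" "a < length xs" "(hd xs, xs ! a) \<in> parcs G"
    using LeastI_ex[OF ex] unfolding a_def by blast
  have least: "a \<le> i" if "longest_path_in G ys" "2 \<le> i" "i < length ys" "(hd ys, ys ! i) \<in> parcs G"
    for ys i
    unfolding a_def using that by (intro Least_le) blast
  have tail: "\<exists>u\<in>set (drop (Suc a) ws). (hd ws, u) \<in> parcs G"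
    if "longest_path_in G ws" "a < length ws" for ws
    using third_neighbour_in_tail[OF bi that hd_deg[OF that(1)]] least by blast

  define P y z R where "P = take (a - 1) xs" and "y = xs ! (a - 1)" and "z = xs ! a"
    and "R = drop (Suc a) xs"
  have lenP: "length P = a - 1" and "P \<noteq> []" using xs by (auto simp: P_def)
  have Pyz: "xs = P @ y # z # R"
    using xs(2,3) Cons_nth_drop_Suc[of "a - 1" xs] Cons_nth_drop_Suc[of a xs]
      append_take_drop_id[of "a - 1" xs]
    by (simp add: P_def y_def z_def R_def)
  then have hd_xs: "hd xs = hd P" using \<open>P \<noteq> []\<close> by simp
  have hdz: "(hd P, z) \<in> parcs G" using xs(4) by (simp add: hd_xs z_def)
  let ?ys = "rev (P @ [y]) @ z # R"
  have ys: "longest_path_in G ?ys"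
    using rotate_longest_path[OF bi, of "P @ [y]" z R] xs(1) hdz \<open>P \<noteq> []\<close> Pyz by simp
  have "drop (Suc a) ?ys = R" using lenP xs(2) by simp
  moreover have "a < length ?ys" using lenP xs(2) by simp
  moreover have "hd ?ys = y" by simp
  ultimately obtain s where s: "s \<in> set R" "(y, s) \<in> parcs G"
    using tail[OF ys] by metis
  obtain r where r: "r \<in> set R" "(hd P, r) \<in> parcs G"
    using tail[OF xs(1,3)] unfolding hd_xs R_def by blast

  have "R \<noteq> []" using r by auto
  have path: "distinct (P @ y # z # R)" "set (P @ y # z # R) \<subseteq> pverts G"
      "successively (\<lambda>u v. (u, v) \<in> parcs G) (P @ y # z # R)"
    using xs(1) Pyz by (auto simp: longest_path_in_def path_in_def)
  have edges: "(last P, y) \<in> parcs G" "(y, z) \<in> parcs G" "(z, hd R) \<in> parcs G"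
    and paths: "successively (\<lambda>u v. (u, v) \<in> parcs G) P" "successively (\<lambda>u v. (u, v) \<in> parcs G) R"
    using path(3) \<open>P \<noteq> []\<close> \<open>R \<noteq> []\<close> by (auto simp: successively_append_iff successively_Cons)
  have ends: "hd P \<in> set P" "last P \<in> set P" "hd R \<in> set R" using \<open>P \<noteq> []\<close> \<open>R \<noteq> []\<close> by auto
  define B where "B = (\<lambda>i. [P, [y], [z], R] ! i)"
  have B: "B 0 = P" "B 1 = [y]" "B 2 = [z]" "B 3 = R" by (simp_all add: B_def)
  have below4: "i < 4 \<longleftrightarrow> i = 0 \<or> i = 1 \<or> i = 2 \<or> i = 3" for i :: nat by auto
  show ?thesis
  proof (rule complete_minor_from_paths[OF bi, of 4 B])
    fix i :: nat assume "i < 4"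
    then show "B i \<noteq> [] \<and> set (B i) \<subseteq> pverts G \<and> successively (\<lambda>u v. (u, v) \<in> parcs G) (B i)"
      using path(2) paths \<open>P \<noteq> []\<close> \<open>R \<noteq> []\<close> unfolding below4 by (auto simp: B B(2)[simplified])
  next
    fix i j :: nat assume "i < j" "j < 4"
    then have "(i, j) \<in> {(0, 1), (0, 2), (0, 3), (1, 2), (1, 3), (2, 3)}"
      unfolding below4 by auto
    then consider "i = 0" "j = 1" | "i = 0" "j = 2" | "i = 0" "j = 3" | "i = 1" "j = 2"
      | "i = 1" "j = 3" | "i = 2" "j = 3" by blast
    then show "set (B i) \<inter> set (B j) = {} \<and> (\<exists>u\<in>set (B i). \<exists>v\<in>set (B j). (u, v) \<in> parcs G)"
      using path(1) edges ends hdz r s by cases (auto simp: B B(2)[simplified])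
  qed
qed

section \<open>Colouring finite graphs\<close>

lemma extend_coloring_at_small_degree:
  assumes bi: "pair_bidirected_digraph G" and fin: "finite (pverts G)"
    and deg: "card (parcs G `` {v}) < k"
    and col: "colorable (induced G (pverts G - {v})) k"
  shows "colorable G k"
proof -
  obtain c where c: "proper_coloring (induced G (pverts G - {v})) k c"
    using col by (auto simp: colorable_def)
  have arcs: "parcs G \<subseteq> pverts G \<times> pverts G" "irrefl (parcs G)"
    and sym: "\<And>u w. (u, w) \<in> parcs G \<Longrightarrow> (w, u) \<in> parcs G"
    using bi by (auto simp: bidirected_iff dest: symD)
  have finN: "finite (parcs G `` {v})" using arcs by (intro finite_subset[OF _ fin]) auto
  have "card (c ` (parcs G `` {v})) < card {..<k}" using card_image_le[OF finN, of c] deg by simp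
  then have "\<not> {..<k} \<subseteq> c ` (parcs G `` {v})" using finN by (metis card_mono finite_imageI not_le)
  then obtain i where i: "i < k" "i \<notin> c ` (parcs G `` {v})" by auto
  have "proper_coloring G k (c(v := i))"
    unfolding proper_coloring_def
  proof (intro conjI allI impI)
    show "c(v := i) \<in> pverts G \<rightarrow> {..<k}" using c i by (auto simp: proper_coloring_def)
    fix u w assume e: "(u, w) \<in> parcs G"
    then have "u \<noteq> w" "u \<in> pverts G" "w \<in> pverts G" using arcs by (auto simp: irrefl_def)
    moreover have "c w \<noteq> i" if "u = v" using that e i by auto
    moreover have "c u \<noteq> i" if "w = v" using that sym[OF e] i by auto
    ultimately show "(c(v := i)) u \<noteq> (c(v := i)) w" using c e by (auto simp: proper_coloring_def)
  qed
  then show ?thesis by (auto simp: colorable_def)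
qed

lemma finite_K4_minor_free_colorable:
  assumes "pair_bidirected_digraph G" "finite (pverts G)" "\<not> has_complete_minor G 4"
  shows "colorable G 3"
  using assms
proof (induction "card (pverts G)" arbitrary: G rule: less_induct)
  case less
  show ?case
  proof (cases "pverts G = {}")
    case True
    then show ?thesis
      using less.prems(1) by (auto simp: colorable_def proper_coloring_def bidirected_iff)
  next
    case False
    with less.prems obtain v where v: "v \<in> pverts G" "card (parcs G `` {v}) < 3"
      using min_degree_three_has_K4_minor by (metis not_le)
    let ?H = "induced G (pverts G - {v})"
    have "\<not> has_complete_minor ?H 4"
      using less.prems induced_subgraph_of[of G "pverts G - {v}"] has_complete_minor_mono by blast
    moreover have "card (pverts ?H) < card (pverts G)"
      using card_Diff1_less[OF less.prems(2) v(1)] by (simp del: card_Diff_insert)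
    ultimately have "colorable ?H 3"
      using less.hyps[of ?H] less.prems induced_bidirected by (auto simp del: card_Diff_insert)
    then show ?thesis by (rule extend_coloring_at_small_degree[OF less.prems(1,2) v(2)])
  qed
qed

section \<open>Compactness of colourings\<close>

text \<open>
  This is the theorem of de Bruijn and Erdos. Colourings, proper or not, form a product of finite
  discrete spaces, which is compact by Tychonoff's theorem. For each edge, the colourings that
  separate its ends form a closed set, and finitely many of these sets intersect because the ends
  of finitely many edges induce a finite subgraph.
\<close>

lemma colorable_if_finite_subgraphs_colorable:
  assumes wf: "parcs G \<subseteq> pverts G \<times> pverts G"
    and fin: "\<And>S. finite S \<Longrightarrow> S \<subseteq> pverts G \<Longrightarrow> colorable (induced G S) k"
  shows "colorable G k"
proof -
  define X where "X = product_topology (\<lambda>_. discrete_topology {..<k}) (pverts G)"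
  define A where "A = (\<lambda>(u, v). {f \<in> topspace X. f u \<noteq> f v})"
  have top: "topspace X = (\<Pi>\<^sub>E v\<in>pverts G. {..<k})" by (simp add: X_def)
  let ?U = "insert (topspace X) (A ` parcs G)"
  have compact: "compact_space X"
    unfolding X_def by (simp add: compact_space_product_topology compact_space_discrete_topology)
  have closed: "\<forall>C\<in>?U. closedin X C"
  proof -
    have "closedin X (A (u, v))" if "(u, v) \<in> parcs G" for u v
    proof -
      have "u \<in> pverts G" "v \<in> pverts G" using that wf by auto
      then have "continuous_map X (discrete_topology ({..<k} \<times> {..<k})) (\<lambda>f. (f u, f v))"
        unfolding X_def prod_topology_discrete_topology
        by (intro continuous_map_pairedI continuous_map_product_projection)
      then have "closedin X {f \<in> topspace X. (f u, f v) \<in> {(i, j) \<in> {..<k} \<times> {..<k}. i \<noteq> j}}"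
        by (rule closedin_continuous_map_preimage) auto
      moreover have "{f \<in> topspace X. (f u, f v) \<in> {(i, j) \<in> {..<k} \<times> {..<k}. i \<noteq> j}} = A (u, v)"
        using \<open>u \<in> pverts G\<close> \<open>v \<in> pverts G\<close> unfolding A_def top by (auto dest: PiE_mem)
      ultimately show ?thesis by simp
    qed
    then show ?thesis by auto
  qed
  have finite_meet: "\<Inter>F \<noteq> {}" if F: "finite F" "F \<subseteq> ?U" for F
  proof -
    have "finite (F - {topspace X})" "F - {topspace X} \<subseteq> A ` parcs G" using F by auto
    from finite_subset_image[OF this] obtain D
      where D: "D \<subseteq> parcs G" "finite D" "F - {topspace X} = A ` D"
      by (elim exE conjE)
    define S where "S = fst ` D \<union> snd ` D"
    have finS: "finite S" using D(2) by (simp add: S_def)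
    have SV: "S \<subseteq> pverts G" using subset_trans[OF D(1) wf] unfolding S_def by fastforce
    obtain c where c: "proper_coloring (induced G S) k c"
      using fin[OF finS SV] unfolding colorable_def by blast
    have k: "0 < k" if "v \<in> pverts G" for v
      using fin[of "{v}"] that by (auto simp: colorable_def proper_coloring_def)
    \<comment> \<open>Vertices outside \<open>S\<close> may get any colour; 0 is one, since \<open>k\<close> colours suffice for a vertex.\<close>
    define f where "f = restrict (\<lambda>v. if v \<in> S then c v else 0) (pverts G)"
    have "f \<in> topspace X"
      unfolding top f_def
    proof (rule restrict_PiE_iff[THEN iffD2], intro ballI)
      fix v assume "v \<in> pverts G"
      moreover have "c v \<in> {..<k}" if "v \<in> S" using c that by (auto simp: proper_coloring_def)
      ultimately show "(if v \<in> S then c v else 0) \<in> {..<k}" using k by simp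
    qed
    moreover have "f u \<noteq> f v" if "(u, v) \<in> D" for u v
    proof -
      have uv: "u \<in> S" "v \<in> S" using that by (force simp: S_def)+
      then have "(u, v) \<in> parcs (induced G S)" using that D(1) by auto
      then have "c u \<noteq> c v" using c unfolding proper_coloring_def by blast
      then show ?thesis using uv SV by (simp add: f_def subset_iff)
    qed
    ultimately have f: "f \<in> topspace X" "\<forall>C\<in>A ` D. f \<in> C" by (auto simp: A_def)
    have "f \<in> C" if "C \<in> F" for C
    proof (cases "C = topspace X")
      case False
      then have "C \<in> A ` D" unfolding D(3)[symmetric] using that by simp
      then show ?thesis by (rule bspec[OF f(2)])
    qed (use f(1) in simp)
    then have "f \<in> \<Inter>F" by (rule InterI)
    then show ?thesis by (metis empty_iff)
  qed
  have "(\<forall>C\<in>?U. closedin X C) \<and> (\<forall>F. finite F \<and> F \<subseteq> ?U \<longrightarrow> \<Inter>F \<noteq> {})"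
    using closed finite_meet by simp
  then have "\<Inter>?U \<noteq> {}" by (rule compact[unfolded compact_space_fip, THEN spec, THEN mp])
  then obtain f where f: "f \<in> topspace X" "\<And>e. e \<in> parcs G \<Longrightarrow> f \<in> A e" by auto
  have "proper_coloring G k f"
    unfolding proper_coloring_def
  proof (intro conjI allI impI)
    show "f \<in> pverts G \<rightarrow> {..<k}" using f(1) unfolding top by auto
    show "f u \<noteq> f v" if "(u, v) \<in> parcs G" for u v using f(2)[OF that] by (simp add: A_def)
  qed
  then show ?thesis by (auto simp: colorable_def)
qed

theorem theorem1:
  fixes G :: "'a pair_pre_digraph"
  assumes "pair_bidirected_digraph G"
    and "\<not> colorable G 3"
  shows "has_complete_minor G 4"
proof -
  have "parcs G \<subseteq> pverts G \<times> pverts G" using assms(1) by (simp add: bidirected_iff)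
  note compactness = colorable_if_finite_subgraphs_colorable[OF this, of 3]
  obtain S where S: "finite S" "S \<subseteq> pverts G" "\<not> colorable (induced G S) 3"
    using compactness assms(2) by metis
  then have "has_complete_minor (induced G S) 4"
    using finite_K4_minor_free_colorable[OF induced_bidirected[OF assms(1)]] by auto
  then show ?thesis
    using induced_subgraph_of[OF assms(1) S(2)] by (rule has_complete_minor_mono)
qed

end
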